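(* Suppose the target density $p(\theta\mid y)$ on $\mathbb{R}^d$ is a multivariate Gaussian $\mathrm{N}(\nu,\Lambda^{-1})$ with precision matrix $\Lambda$, and the variational family consists of the Gaussians $q(\theta)=\mathrm{N}(\mu,\Sigma)$ with diagonal covariance matrix $\Sigma$. Let $\hat\Sigma^{\mathrm{KL}}_{ii}$, $\hat\Sigma^{M}_{ii}$ and $\hat\Sigma^{S}_{ii}$ denote the optimal value of the $i$th diagonal element of $\Sigma$ obtained by minimizing the Kullback-Leibler divergence $\mathrm{KL}(q\|p)$, the $M$-weighted Fisher divergence $S_M(q\|p)$, and the score-based divergence $S(q\|p)$, respectively, where $M$ is a positive definite diagonal matrix independent of $\Sigma$. Then $$\hat\Sigma^{M}_{ii}\le\hat\Sigma^{\mathrm{KL}}_{ii}\quad\text{and}\quad \hat\Sigma^{S}_{ii}\le\hat\Sigma^{\mathrm{KL}}_{ii}\qquad\text{for } i=1,\dots,d,$$ and there exists $i\in\{1,\dots,d\}$ such that $\hat\Sigma^{M}_{ii}<\hat\Sigma^{\mathrm{KL}}_{ii}$ and $\hat\Sigma^{S}_{ii}<\hat\Sigma^{\mathrm{KL}}_{ii}$.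
   Context: $\mathrm{KL}(q\|p)=\int q(\theta)\log\frac{q(\theta)}{p(\theta|y)}\,d\theta$. For a positive semidefinite matrix $M$, $\|z\|_M=\sqrt{z^\top M z}$ and the $M$-weighted Fisher divergence is $S_M(q\|p)=\int q(\theta)\,\big\|\nabla_\theta\log\frac{q(\theta)}{p(\theta|y)}\big\|_M^2\,d\theta$; the weight $M$ in the theorem also does not depend on $\mu$. The score-based divergence $S(q\|p)$ is $S_\Sigma(q\|p)$, i.e. the weight matrix is the covariance matrix $\Sigma$ of $q=\mathrm{N}(\mu,\Sigma)$. The precision matrix $\Lambda$ is symmetric positive definite. Minimization is over $\mu\in\mathbb{R}^d$ and diagonal $\Sigma$. For the score-based divergence, minimization is understood with the nonnegativity constraint $\Sigma_{ii}\ge 0$ (a diagonal entry may be $0$ at the optimum): at the optimal mean $\mu=\nu$ the objective equals $d+\sum_{i,j=1}^d\Sigma_{ii}\Sigma_{jj}\Lambda_{ij}^2-2\sum_{i=1}^d\Sigma_{ii}\Lambda_{ii}$, which is minimized over $\Sigma_{11},\dots,\Sigma_{dd}\ge 0$.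
   Formalization: The existence of an index i with both strict inequalities is claimed only when the precision matrix Λ is not diagonal; for diagonal Λ (in particular d = 1) the KL and M-weighted optima coincide, both equal to 1/Λ_ii, so the strict claim fails. *)

theory Defs
  imports "HOL-Probability.Probability"
begin

definition diagonal_matrix :: "real ^ 'n ^ 'n \<Rightarrow> bool"
  where "diagonal_matrix A \<longleftrightarrow> (\<forall>i j. i \<noteq> j \<longrightarrow> A $ i $ j = 0)"

definition pos_semidef_matrix :: "real ^ 'n ^ 'n \<Rightarrow> bool"
  where "pos_semidef_matrix A \<longleftrightarrow> transpose A = A \<and> (\<forall>x. 0 \<le> x \<bullet> (A *v x))"

definition pos_def_matrix :: "real ^ 'n ^ 'n \<Rightarrow> bool"
  where "pos_def_matrix A \<longleftrightarrow> transpose A = A \<and> (\<forall>x. x \<noteq> 0 \<longrightarrow> 0 < x \<bullet> (A *v x))"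

definition gaussian_density :: "real ^ 'n \<Rightarrow> real ^ 'n ^ 'n \<Rightarrow> real ^ 'n \<Rightarrow> real"
  where "gaussian_density \<mu> \<Sigma> \<theta> =
    exp (- ((\<theta> - \<mu>) \<bullet> (matrix_inv \<Sigma> *v (\<theta> - \<mu>))) / 2) / sqrt ((2 * pi) ^ CARD('n) * det \<Sigma>)"

text \<open>The library's \<^const>\<open>KL_divergence\<close> takes the reference measure first, so the arguments
  are swapped here.\<close>

definition KL_div :: "(real ^ 'n \<Rightarrow> real) \<Rightarrow> (real ^ 'n \<Rightarrow> real) \<Rightarrow> real"
  where "KL_div q p = KL_divergence (exp 1)
    (density lborel (\<lambda>\<theta>. ennreal (p \<theta>))) (density lborel (\<lambda>\<theta>. ennreal (q \<theta>)))"

lemma KL_div_eq_integral: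
  assumes "p \<in> borel_measurable borel" "q \<in> borel_measurable borel"
    and "\<And>\<theta>. 0 < p \<theta>" "\<And>\<theta>. 0 \<le> q \<theta>"
  shows "KL_div q p = (\<integral>\<theta>. q \<theta> * ln (q \<theta> / p \<theta>) \<partial>lborel)"
proof -
  have "KL_div q p = (\<integral>\<theta>. q \<theta> * log (exp 1) (q \<theta> / p \<theta>) \<partial>lborel)"
    unfolding KL_div_def using assms
    by (intro lborel.KL_density_density) (auto intro: less_imp_le simp: less_imp_neq[symmetric])
  then show ?thesis by (simp add: log_def)
qed

definition gradient :: "('a::real_inner \<Rightarrow> real) \<Rightarrow> 'a \<Rightarrow> 'a"
  where "gradient f x = (THE D. GDERIV f x :> D)"

lemma gradient_eqI: "gradient f x = D" if "GDERIV f x :> D"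
  unfolding gradient_def
proof (rule the_equality)
  fix D' assume "GDERIV f x :> D'"
  with that have "(\<lambda>h. h \<bullet> D') = (\<lambda>h. h \<bullet> D)"
    unfolding gderiv_def by (rule has_derivative_unique[rotated])
  then have "\<And>h. h \<bullet> D' = h \<bullet> D" by meson
  then show "D' = D"
    by (metis inner_commute vector_eq_ldot)
qed fact

definition weighted_norm :: "real ^ 'n ^ 'n \<Rightarrow> real ^ 'n \<Rightarrow> real"
  where "weighted_norm M z = sqrt (z \<bullet> (M *v z))"

definition fisher_div ::
    "real ^ 'n ^ 'n \<Rightarrow> (real ^ 'n \<Rightarrow> real) \<Rightarrow> (real ^ 'n \<Rightarrow> real) \<Rightarrow> real"
  where "fisher_div M q p =
    (\<integral>\<theta>. q \<theta> * (weighted_norm M (gradient (\<lambda>t. ln (q t / p t)) \<theta>))\<^sup>2 \<partial>lborel)"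

text \<open>For a nonsingular covariance matrix this is the Fisher divergence of \<open>N(\<mu>, \<Sigma>)\<close> from \<open>p\<close>
  weighted by \<open>\<Sigma>\<close> itself. A diagonal \<open>\<Sigma>\<close> with some zero entries gives no density; there the
  value is the limit of the divergence along nonsingular diagonal covariance matrices. For
  \<open>p = N(\<nu>, \<Lambda>\<^sup>-\<^sup>1)\<close> and \<open>\<mu> = \<nu>\<close> this is the polynomial
  \<open>d + (\<Sum>i j. \<Sigma>\<^sub>i\<^sub>i \<Sigma>\<^sub>j\<^sub>j \<Lambda>\<^sub>i\<^sub>j\<^sup>2) - 2 (\<Sum>i. \<Sigma>\<^sub>i\<^sub>i \<Lambda>\<^sub>i\<^sub>i)\<close> for all diagonal entries \<open>\<Sigma>\<^sub>i\<^sub>i \<ge> 0\<close>.\<close>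

definition score_div ::
    "real ^ 'n \<Rightarrow> real ^ 'n ^ 'n \<Rightarrow> (real ^ 'n \<Rightarrow> real) \<Rightarrow> real"
  where "score_div \<mu> \<Sigma> p =
    (if pos_def_matrix \<Sigma> then fisher_div \<Sigma> (gaussian_density \<mu> \<Sigma>) p
     else Lim (at \<Sigma> within {T. diagonal_matrix T \<and> pos_def_matrix T})
       (\<lambda>T. fisher_div T (gaussian_density \<mu> T) p))"

end

(* For Gaussian q and p with precision Lambda, and diagonal Sigma = diag(s), all three divergences
   are explicit functions of s: up to terms constant in s, the Kullback-Leibler divergence is half
   of sum_i (Lambda_ii s_i - ln s_i), the M-weighted Fisher divergence is
   sum_i (a_i s_i + m_i / s_i) with a_i = sum_k m_k Lambda_ki^2, and the score-based divergence is a
   quadratic polynomial with quadratic part sum_ij Lambda_ij^2 s_i s_j.  Varying one entry of s with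
   mu held fixed gives s_i = 1 / Lambda_ii for KL, s_i^2 = m_i / a_i for M, and, whenever s_i > 0,
   sum_j Lambda_ij^2 s_j <= Lambda_ii for the score, so the optimal mean never has to be
   determined.  The inequalities follow from a_i >= m_i Lambda_ii^2 and
   Lambda_ii^2 s_i <= sum_j Lambda_ij^2 s_j.  For strictness take Lambda_ij nonzero, i different
   from j: the index i works if the score optimum has s_j > 0, and j works otherwise. *)

theory Submission
  imports Defs
begin

subsection \<open>Diagonal and positive definite matrices\<close>

text \<open>Entries come from a function, so that varying a single variance is the update
  \<open>s(i := t)\<close>.\<close>

definition diag_mat :: "('n \<Rightarrow> real) \<Rightarrow> real ^ 'n ^ 'n"
  where "diag_mat s = (\<chi> i j. if i = j then s i else 0)"

lemma diag_mat_nth [simp]: "diag_mat s $ i $ j = (if i = j then s i else 0)"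
  by (simp add: diag_mat_def)

lemma diagonal_diag_mat [simp]: "diagonal_matrix (diag_mat s)"
  by (simp add: diagonal_matrix_def)

lemma diagonal_matrix_eqI:
  assumes "diagonal_matrix A" "\<And>i. A $ i $ i = s i"
  shows "A = diag_mat s"
  using assms by (simp add: diagonal_matrix_def vec_eq_iff)

lemma transpose_diag_mat [simp]: "transpose (diag_mat s) = diag_mat s"
  by (simp add: vec_eq_iff transpose_def)

lemma diag_mat_mult_vec_nth [simp]: "(diag_mat s *v x) $ i = s i * x $ i"
  by (simp add: matrix_vector_mult_def if_distrib[of "\<lambda>c. c * _"] cong: if_cong)

lemma inner_diag_mat: "x \<bullet> (diag_mat s *v x) = (\<Sum>i\<in>UNIV. s i * (x $ i)\<^sup>2)"
  by (simp add: inner_vec_def power2_eq_square mult_ac)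

lemma det_diag_mat: "det (diag_mat s) = (\<Prod>i\<in>UNIV. s i)"
  by (subst det_diagonal) auto

text \<open>Evaluating the quadratic form at a basis vector reads off a diagonal entry; this is how
  definiteness and semidefiniteness yield the signs of the variances.\<close>

lemma axis_inner_matrix_mult_axis: "axis i 1 \<bullet> (A *v axis j 1) = A $ i $ j" for A :: "real ^ 'n ^ 'm"
  by (simp add: matrix_vector_mult_basis column_def inner_axis')

lemma pos_semidef_matrix_diag: "pos_semidef_matrix A \<Longrightarrow> 0 \<le> A $ i $ i"
  unfolding pos_semidef_matrix_def axis_inner_matrix_mult_axis[of i A i, symmetric] by blast

lemma pos_def_matrix_diag: "pos_def_matrix A \<Longrightarrow> 0 < A $ i $ i"
  unfolding pos_def_matrix_def axis_inner_matrix_mult_axis[of i A i, symmetric]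
  by (simp add: axis_eq_0_iff)

lemma pos_semidef_diag_mat_iff: "pos_semidef_matrix (diag_mat s) \<longleftrightarrow> (\<forall>i. 0 \<le> s i)"
proof
  assume "pos_semidef_matrix (diag_mat s)"
  then show "\<forall>i. 0 \<le> s i" using pos_semidef_matrix_diag[of "diag_mat s"] by simp
qed (simp add: pos_semidef_matrix_def inner_diag_mat sum_nonneg)

lemma pos_def_diag_mat_iff: "pos_def_matrix (diag_mat s) \<longleftrightarrow> (\<forall>i. 0 < s i)"
proof
  assume "pos_def_matrix (diag_mat s)"
  then show "\<forall>i. 0 < s i" using pos_def_matrix_diag[of "diag_mat s"] by simp
next
  assume s: "\<forall>i. 0 < s i"
  have "0 < (\<Sum>i\<in>UNIV. s i * (x $ i)\<^sup>2)" if "x \<noteq> 0" for x :: "real ^ 'a"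
  proof -
    from that obtain k where "x $ k \<noteq> 0" by (auto simp: vec_eq_iff)
    with s show ?thesis
      by (intro sum_pos2[of _ k]) (auto intro!: mult_nonneg_nonneg simp: less_imp_le)
  qed
  then show "pos_def_matrix (diag_mat s)"
    by (simp add: pos_def_matrix_def inner_diag_mat)
qed

lemma matrix_inv_mult:
  fixes A :: "real ^ 'n ^ 'n"
  assumes "invertible A"
  shows "A ** matrix_inv A = mat 1" and "matrix_inv A ** A = mat 1"
  using someI_ex[OF assms[unfolded invertible_def]] by (simp_all add: matrix_inv_def)

lemma matrix_inv_eqI:
  fixes A B :: "real ^ 'n ^ 'n"
  assumes "A ** B = mat 1"
  shows "matrix_inv A = B"
proof -
  have "invertible A" using assms invertible_right_inverse by blast
  then have "matrix_inv A = matrix_inv A ** (A ** B)" by (simp add: assms)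
  also have "\<dots> = B"
    by (simp only: matrix_mul_assoc matrix_inv_mult[OF \<open>invertible A\<close>] matrix_mul_lid)
  finally show ?thesis .
qed

lemma matrix_inv_diag_mat:
  assumes "\<And>i. s i \<noteq> 0"
  shows "matrix_inv (diag_mat s) = diag_mat (\<lambda>i. 1 / s i)"
  by (rule matrix_inv_eqI)
    (simp add: vec_eq_iff matrix_matrix_mult_def mat_def assms if_distrib[of "\<lambda>c. c * _"] cong: if_cong)

text \<open>A nonzero kernel vector would make the quadratic form vanish.\<close>

lemma pos_def_det_nonzero:
  assumes "pos_def_matrix A"
  shows "det A \<noteq> 0"
proof
  assume "det A = 0"
  then have "\<not> invertible A" by (simp add: invertible_det_nz)
  then obtain x where "x \<noteq> 0" "A *v x = 0"
    unfolding invertible_left_inverse matrix_left_invertible_ker by auto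
  with assms show False unfolding pos_def_matrix_def by fastforce
qed

text \<open>The segment from the identity to \<open>A\<close> consists of nonsingular matrices.\<close>

lemma pos_def_det_pos:
  fixes A :: "real ^ 'n ^ 'n"
  assumes A: "pos_def_matrix A"
  shows "0 < det A"
proof (rule ccontr)
  define f where "f t = det ((1 - t) *\<^sub>R mat 1 + t *\<^sub>R A)" for t :: real
  assume "\<not> 0 < det A"
  then have "f 1 \<le> 0" "0 \<le> f 0" by (simp_all add: f_def)
  moreover have "continuous_on {0..1} f"
    unfolding f_def det_def by (intro continuous_intros)
  ultimately obtain t where t: "0 \<le> t" "t \<le> 1" "f t = 0"
    using IVT2'[of f 1 0 0] by auto
  have "pos_def_matrix ((1 - t) *\<^sub>R mat 1 + t *\<^sub>R A)"
    unfolding pos_def_matrix_def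
  proof (intro conjI allI impI)
    show "transpose ((1 - t) *\<^sub>R mat 1 + t *\<^sub>R A) = (1 - t) *\<^sub>R mat 1 + t *\<^sub>R A"
      using A by (auto simp: pos_def_matrix_def transpose_def vec_eq_iff mat_def)
    fix x :: "real ^ 'n" assume x: "x \<noteq> 0"
    then have p: "0 < x \<bullet> x" "0 < x \<bullet> (A *v x)" using A by (auto simp: pos_def_matrix_def)
    have "0 < (1 - t) * (x \<bullet> x) + t * (x \<bullet> (A *v x))"
    proof (cases "t = 0")
      case False
      with t p show ?thesis by (intro add_nonneg_pos mult_pos_pos mult_nonneg_nonneg) auto
    qed (use p in simp)
    then show "0 < x \<bullet> (((1 - t) *\<^sub>R mat 1 + t *\<^sub>R A) *v x)"
      by (simp add: matrix_vector_mult_add_rdistrib inner_add_right scaleR_matrix_vector_assoc[symmetric])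
  qed
  then show False using pos_def_det_nonzero t(3) unfolding f_def by blast
qed

text \<open>The target has covariance \<open>matrix_inv \<Lambda>\<close>: the first fact makes its
  density positive, the second turns the matrix in its exponent back into
  \<open>\<Lambda>\<close>.\<close>

lemma pos_def_matrix_inv:
  fixes A :: "real ^ 'n ^ 'n"
  assumes "pos_def_matrix A"
  shows "0 < det (matrix_inv A)" and "matrix_inv (matrix_inv A) = A"
proof -
  have "invertible A" using pos_def_det_pos[OF assms] by (simp add: invertible_det_nz)
  note inv = matrix_inv_mult[OF this]
  have "det A * det (matrix_inv A) = 1" using arg_cong[OF inv(1), of det] by (simp add: det_mul)
  with pos_def_det_pos[OF assms] show "0 < det (matrix_inv A)"
    using zero_less_mult_pos[of "det A" "det (matrix_inv A)"] by simp
  show "matrix_inv (matrix_inv A) = A" by (rule matrix_inv_eqI[OF inv(2)])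
qed

subsection \<open>Gaussian integrals with diagonal covariance\<close>

text \<open>Lebesgue measure on \<open>real ^ 'n\<close> is the image of the product of
  one-dimensional Lebesgue measures indexed by \<open>Basis\<close>. Fubini for products of
  functions, reindexed from basis vectors to coordinates, gives integrability and value at
  once.\<close>

lemma has_bochner_integral_lborel_prod:
  fixes f :: "'n :: finite \<Rightarrow> real \<Rightarrow> real"
  assumes f: "\<And>i. integrable lborel (f i)"
  shows "has_bochner_integral lborel (\<lambda>x :: real ^ 'n. \<Prod>i\<in>UNIV. f i (x $ i))
    (\<Prod>i\<in>UNIV. integral\<^sup>L lborel (f i))"
proof -
  interpret product_sigma_finite "\<lambda>b :: real ^ 'n. lborel :: real measure" by standard
  have [measurable]: "f i \<in> borel_measurable borel" for i
    using borel_measurable_integrable[OF f[of i]] by simp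
  let ?B = "Basis :: (real ^ 'n) set"
  have B: "?B = range (\<lambda>i. axis i 1)" by (auto simp: Basis_vec_def)
  have inj: "inj (\<lambda>i :: 'n. axis i (1 :: real))" by (auto simp: inj_def axis_eq_axis)
  have ix: "axis_index (axis i (1 :: real)) = i" for i :: 'n by simp
  have nth: "(\<Sum>b\<in>?B. y b *\<^sub>R b) $ i = y (axis i 1)" for y i
  proof -
    have "(\<Sum>b\<in>?B. y b *\<^sub>R b) $ i = (\<Sum>j\<in>UNIV. y (axis j 1) * axis j 1 $ i)"
      unfolding B by (simp add: sum.reindex[OF inj])
    also have "\<dots> = (\<Sum>j\<in>UNIV. if j = i then y (axis j 1) else 0)"
      by (rule sum.cong) (auto simp: axis_def)
    finally show ?thesis by simp
  qed
  have "has_bochner_integral (\<Pi>\<^sub>M b\<in>?B. lborel) (\<lambda>y. \<Prod>b\<in>?B. f (axis_index b) (y b))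
      (\<Prod>b\<in>?B. integral\<^sup>L lborel (f (axis_index b)))"
    using product_integrable_prod[of ?B "\<lambda>b. f (axis_index b)"]
      product_integral_prod[of ?B "\<lambda>b. f (axis_index b)"] f
    by (simp add: has_bochner_integral_iff)
  then have "has_bochner_integral (\<Pi>\<^sub>M b\<in>?B. lborel) (\<lambda>y. \<Prod>i\<in>UNIV. f i ((\<Sum>b\<in>?B. y b *\<^sub>R b) $ i))
      (\<Prod>i\<in>UNIV. integral\<^sup>L lborel (f i))"
    unfolding nth by (simp add: B prod.reindex[OF inj] ix)
  moreover have "(\<lambda>x :: real ^ 'n. \<Prod>i\<in>UNIV. f i (x $ i)) \<in> borel_measurable borel"
    by measurable
  moreover have "(\<lambda>y. \<Sum>b\<in>?B. y b *\<^sub>R b) \<in> measurable (\<Pi>\<^sub>M b\<in>?B. lborel) borel"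
    by measurable
  ultimately show ?thesis
    unfolding lborel_eq[where 'a = "real ^ 'n"] by (intro has_bochner_integral_distr)
qed

text \<open>Independence of the coordinates: this reduces every Gaussian integral below to moments
  of one-dimensional normal densities, whose parameter is the standard deviation, hence the
  \<open>sqrt (s i)\<close>.\<close>

lemma gaussian_density_diag_mat:
  assumes s: "\<And>i. 0 < s i"
  shows "gaussian_density \<mu> (diag_mat s) \<theta> =
    (\<Prod>i\<in>UNIV. normal_density (\<mu> $ i) (sqrt (s i)) (\<theta> $ i))"
proof -
  have s0: "s i \<noteq> 0" "0 \<le> s i" for i using s[of i] by auto
  have "(2 * pi) ^ CARD('a) * prod s UNIV = (\<Prod>i\<in>UNIV. 2 * pi * s i)"
    by (simp add: prod.distrib)
  moreover have "sqrt (\<Prod>i\<in>UNIV. 2 * pi * s i) = (\<Prod>i\<in>UNIV. sqrt (2 * pi * s i))"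
    using prod_power_distrib[of "\<lambda>i. sqrt (2 * pi * s i)" UNIV 2] s0(2)
    by (intro real_sqrt_unique) (auto intro!: prod_nonneg)
  moreover have "- ((\<theta> - \<mu>) \<bullet> (matrix_inv (diag_mat s) *v (\<theta> - \<mu>))) / 2 =
      (\<Sum>i\<in>UNIV. - (\<theta> $ i - \<mu> $ i)\<^sup>2 / (2 * s i))"
    by (simp add: matrix_inv_diag_mat s0 inner_diag_mat sum_negf sum_divide_distrib mult.commute)
  ultimately show ?thesis
    by (simp add: gaussian_density_def det_diag_mat normal_density_def exp_sum prod_dividef s0)
qed

text \<open>Common source of the moments of order 0, 1 and 2, obtained by choosing the exponents
  \<open>e\<close>.\<close>

lemma gaussian_diag_product_moment:
  assumes s: "\<And>i. 0 < s i"
  shows "has_bochner_integral lborel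
      (\<lambda>\<theta>. gaussian_density \<mu> (diag_mat s) \<theta> * (\<Prod>i\<in>UNIV. ((\<theta> - \<mu>) $ i) ^ e i))
      (\<Prod>i\<in>UNIV. \<integral>x. normal_density (\<mu> $ i) (sqrt (s i)) x * (x - \<mu> $ i) ^ e i \<partial>lborel)"
  using has_bochner_integral_lborel_prod
    [of "\<lambda>i x. normal_density (\<mu> $ i) (sqrt (s i)) x * (x - \<mu> $ i) ^ e i"] s
  by (simp add: integrable_normal_moment gaussian_density_diag_mat[OF s] prod.distrib)

lemma gaussian_diag_total_mass:
  assumes s: "\<And>i. 0 < s i"
  shows "has_bochner_integral lborel (gaussian_density \<mu> (diag_mat s)) 1"
  using gaussian_diag_product_moment[of s \<mu> "\<lambda>_. 0", OF s] s by simp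

lemma prod_power_delta:
  fixes f :: "'a :: finite \<Rightarrow> 'b :: comm_monoid_mult"
  shows "(\<Prod>k\<in>UNIV. f k ^ (if k = i then 1 else 0)) = f i"
proof -
  have "(\<Prod>k\<in>UNIV. f k ^ (if k = i then 1 else 0)) = (\<Prod>k\<in>UNIV. if k = i then f k else 1)"
    by (rule prod.cong) auto
  then show ?thesis by simp
qed

lemma gaussian_diag_mean:
  assumes s: "\<And>i. 0 < s i"
  shows "has_bochner_integral lborel
    (\<lambda>\<theta>. gaussian_density \<mu> (diag_mat s) \<theta> * (\<theta> - \<mu>) $ i) 0"
proof -
  \<comment> \<open>The factor \<open>k = i\<close> is a first central moment, so the whole product
    vanishes.\<close>
  have "(\<Prod>k\<in>UNIV. \<integral>x. normal_density (\<mu> $ k) (sqrt (s k)) x *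
      (x - \<mu> $ k) ^ (if k = i then 1 else 0) \<partial>lborel) = 0"
    using integral_normal_moment_odd[of "sqrt (s i)" "\<mu> $ i" 0] s
    by (intro prod_zero) (auto intro!: bexI[of _ i])
  then show ?thesis
    using gaussian_diag_product_moment[of s \<mu> "\<lambda>k. if k = i then 1 else 0", OF s]
    by (simp only: prod_power_delta)
qed

lemma gaussian_diag_covariance:
  assumes s: "\<And>i. 0 < s i"
  shows "has_bochner_integral lborel
    (\<lambda>\<theta>. gaussian_density \<mu> (diag_mat s) \<theta> * ((\<theta> - \<mu>) $ i * (\<theta> - \<mu>) $ j))
    (if i = j then s i else 0)"
proof -
  \<comment> \<open>The two indicators add up to exponent 2 when \<open>i = j\<close>, so the
    diagonal case is a second moment, while for \<open>i \<noteq> j\<close> coordinate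
    \<open>i\<close> contributes an odd moment.\<close>
  define e where "e k = (if k = i then 1 else 0) + (if k = j then 1 else 0 :: nat)" for k
  let ?m = "\<lambda>k. \<integral>x. normal_density (\<mu> $ k) (sqrt (s k)) x * (x - \<mu> $ k) ^ e k \<partial>lborel"
  have "(\<Prod>k\<in>UNIV. (x $ k) ^ e k) = x $ i * x $ j" for x :: "real ^ 'a"
    by (simp only: e_def power_add prod.distrib prod_power_delta)
  moreover have "prod ?m UNIV = (if i = j then s i else 0)"
  proof (cases "i = j")
    case True
    have "?m k = (if k = i then s i else 1)" for k
      using integral_normal_moment_even[of "sqrt (s k)" "\<mu> $ k" 1] s[of k] True
      by (auto simp: e_def numeral_2_eq_2 [symmetric])
    then have "prod ?m UNIV = (\<Prod>k\<in>UNIV. if k = i then s i else 1)" by (rule prod.cong[OF refl])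
    with True show ?thesis by simp
  next
    case False
    then have "?m i = 0"
      using integral_normal_moment_odd[of "sqrt (s i)" "\<mu> $ i" 0] s[of i] by (simp add: e_def)
    then have "prod ?m UNIV = 0" by (intro prod_zero) auto
    with False show ?thesis by simp
  qed
  ultimately show ?thesis
    using gaussian_diag_product_moment[of s \<mu> e, OF s] by (simp only:)
qed

text \<open>The linear part has mean zero, and independence leaves only the diagonal of
  \<open>B\<close>. Both the KL and the Fisher integrand have this shape, the latter through squares
  of affine functions.\<close>

lemma gaussian_diag_quadratic:
  assumes s: "\<And>i. 0 < s i"
  shows "has_bochner_integral lborel
    (\<lambda>\<theta>. gaussian_density \<mu> (diag_mat s) \<theta> *
      ((\<theta> - \<mu>) \<bullet> (B *v (\<theta> - \<mu>)) + b \<bullet> (\<theta> - \<mu>) + c))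
    ((\<Sum>i\<in>UNIV. B $ i $ i * s i) + c)"
proof -
  let ?g = "gaussian_density \<mu> (diag_mat s)"
  have "has_bochner_integral lborel
      (\<lambda>\<theta>. (\<Sum>i\<in>UNIV. \<Sum>j\<in>UNIV. B $ i $ j * (?g \<theta> * ((\<theta> - \<mu>) $ i * (\<theta> - \<mu>) $ j))) +
        (\<Sum>i\<in>UNIV. b $ i * (?g \<theta> * (\<theta> - \<mu>) $ i)) + c * ?g \<theta>)
      ((\<Sum>i\<in>UNIV. \<Sum>j\<in>UNIV. B $ i $ j * (if i = j then s i else 0)) + (\<Sum>i\<in>UNIV. b $ i * 0) + c * 1)"
    by (intro has_bochner_integral_add has_bochner_integral_sum has_bochner_integral_mult_right
        gaussian_diag_covariance gaussian_diag_mean gaussian_diag_total_mass s)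
  moreover have "(\<Sum>i\<in>UNIV. \<Sum>j\<in>UNIV. B $ i $ j * (?g \<theta> * (x $ i * x $ j))) = ?g \<theta> * (x \<bullet> (B *v x))" for x \<theta>
    by (simp add: inner_vec_def matrix_vector_mult_def sum_distrib_left mult_ac)
  moreover have "(\<Sum>i\<in>UNIV. b $ i * (?g \<theta> * x $ i)) = ?g \<theta> * (b \<bullet> x)" for x \<theta>
    by (simp add: inner_vec_def sum_distrib_left mult_ac)
  moreover have "(\<Sum>i\<in>UNIV. \<Sum>j\<in>UNIV. B $ i $ j * (if i = j then s i else 0)) = (\<Sum>i\<in>UNIV. B $ i $ i * s i)"
    by (simp add: if_distrib cong: if_cong)
  moreover have "c * ?g \<theta> = ?g \<theta> * c" for \<theta> by simp
  ultimately show ?thesis by (simp only: distrib_left [symmetric] mult_1_right mult_zero_right sum.neutral_const add_0_right)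
qed

lemma gaussian_diag_affine_square:
  assumes s: "\<And>i. 0 < s i"
  shows "has_bochner_integral lborel
    (\<lambda>\<theta>. gaussian_density \<mu> (diag_mat s) \<theta> * (a \<bullet> (\<theta> - \<mu>) + c)\<^sup>2)
    ((\<Sum>i\<in>UNIV. s i * (a $ i)\<^sup>2) + c\<^sup>2)"
proof -
  \<comment> \<open>The rank-one matrix of the form whose value at \<open>x\<close> is the square of
    \<open>a \<bullet> x\<close>.\<close>
  define B where "B = (\<chi> i j. a $ i * a $ j)"
  have "x \<bullet> (B *v x) = (a \<bullet> x)\<^sup>2" for x
    by (simp add: B_def inner_vec_def matrix_vector_mult_def power2_eq_square sum_product
        sum_distrib_left mult_ac)
  then have "(a \<bullet> x + c)\<^sup>2 = x \<bullet> (B *v x) + ((2 * c) *\<^sub>R a) \<bullet> x + c\<^sup>2" for x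
    by (simp add: power2_sum)
  then show ?thesis
    using gaussian_diag_quadratic[of s \<mu> B "(2 * c) *\<^sub>R a" "c\<^sup>2", OF s]
    by (simp add: B_def power2_eq_square mult_ac)
qed

section \<open>Logarithms of Gaussian density ratios and their gradients\<close>

lemma gaussian_density_pos: "0 < det C \<Longrightarrow> 0 < gaussian_density \<mu> C \<theta>"
  by (simp add: gaussian_density_def)

lemma borel_measurable_gaussian_density [measurable]:
  "gaussian_density \<mu> C \<in> borel_measurable borel"
  unfolding gaussian_density_def
  unfolding divide_inverse
  by (intro borel_measurable_continuous_onI continuous_intros
      bounded_linear.continuous_on[OF matrix_vector_mul_bounded_linear])

lemma ln_gaussian_density:
  fixes \<mu> :: "real ^ 'n"
  assumes "0 < det C"
  shows "ln (gaussian_density \<mu> C \<theta>) =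
    - ((\<theta> - \<mu>) \<bullet> (matrix_inv C *v (\<theta> - \<mu>))) / 2 - (CARD('n) * ln (2 * pi) + ln (det C)) / 2"
  using assms by (simp add: gaussian_density_def ln_div ln_sqrt ln_mult ln_realpow algebra_simps)

lemma ln_gaussian_ratio:
  fixes \<mu> \<nu> :: "real ^ 'n"
  assumes "0 < det C" "0 < det D"
  shows "ln (gaussian_density \<mu> C \<theta> / gaussian_density \<nu> D \<theta>) =
    ((\<theta> - \<nu>) \<bullet> (matrix_inv D *v (\<theta> - \<nu>)) - (\<theta> - \<mu>) \<bullet> (matrix_inv C *v (\<theta> - \<mu>))
      + ln (det D) - ln (det C)) / 2"
  using gaussian_density_pos[OF assms(1), of \<mu> \<theta>] gaussian_density_pos[OF assms(2), of \<nu> \<theta>]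
  by (simp add: ln_div ln_gaussian_density assms field_simps)

lemma GDERIV_quadratic_form:
  fixes A :: "real ^ 'n ^ 'n"
  assumes "transpose A = A"
  shows "GDERIV (\<lambda>x. (x - a) \<bullet> (A *v (x - a))) x :> 2 *\<^sub>R (A *v (x - a))"
proof -
  have "((\<lambda>x. (x - a) \<bullet> (A *v (x - a))) has_derivative
      (\<lambda>h. (x - a) \<bullet> (A *v h) + h \<bullet> (A *v (x - a)))) (at x)"
    by (auto intro!: derivative_eq_intros bounded_linear.has_derivative[OF matrix_vector_mul_bounded_linear])
  \<comment> \<open>Symmetry merges the two terms of the product rule, which produces the factor
    2.\<close>
  moreover have "(x - a) \<bullet> (A *v h) = h \<bullet> (A *v (x - a))" for h
    by (metis assms dot_lmul_matrix inner_commute transpose_matrix_vector)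
  ultimately show ?thesis by (simp add: gderiv_def)
qed

text \<open>The log-determinants are constants and disappear, so the gradient is affine in
  \<open>\<theta>\<close> and its weighted squared norm is quadratic.\<close>

lemma gradient_ln_gaussian_ratio:
  fixes \<mu> \<nu> :: "real ^ 'n"
  assumes "0 < det C" "0 < det D"
    and "transpose (matrix_inv C) = matrix_inv C" "transpose (matrix_inv D) = matrix_inv D"
  shows "gradient (\<lambda>t. ln (gaussian_density \<mu> C t / gaussian_density \<nu> D t)) \<theta> =
    matrix_inv D *v (\<theta> - \<nu>) - matrix_inv C *v (\<theta> - \<mu>)"
proof (rule gradient_eqI)
  have "GDERIV (\<lambda>t. (t - \<nu>) \<bullet> (matrix_inv D *v (t - \<nu>)) - (t - \<mu>) \<bullet> (matrix_inv C *v (t - \<mu>)) +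
      (ln (det D) - ln (det C))) \<theta> :>
      2 *\<^sub>R (matrix_inv D *v (\<theta> - \<nu>)) - 2 *\<^sub>R (matrix_inv C *v (\<theta> - \<mu>)) + 0"
    by (intro GDERIV_add GDERIV_diff GDERIV_const GDERIV_quadratic_form assms)
  from GDERIV_DERIV_compose[OF this, of "\<lambda>y. y / 2" "1 / 2"]
  show "GDERIV (\<lambda>t. ln (gaussian_density \<mu> C t / gaussian_density \<nu> D t)) \<theta> :>
      matrix_inv D *v (\<theta> - \<nu>) - matrix_inv C *v (\<theta> - \<mu>)"
    by (simp add: ln_gaussian_ratio assms DERIV_cdivide scaleR_diff_right add_diff_eq)
qed

subsection \<open>Closed forms of the divergences\<close>

lemma KL_div_gaussian_diag:
  fixes \<mu> \<nu> :: "real ^ 'n"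
  assumes \<Lambda>: "pos_def_matrix \<Lambda>" and s: "\<And>i. 0 < s i"
  shows "KL_div (gaussian_density \<mu> (diag_mat s)) (gaussian_density \<nu> (matrix_inv \<Lambda>)) =
    ((\<Sum>i\<in>UNIV. \<Lambda> $ i $ i * s i - ln (s i)) + (\<mu> - \<nu>) \<bullet> (\<Lambda> *v (\<mu> - \<nu>))
      - CARD('n) + ln (det (matrix_inv \<Lambda>))) / 2"
proof -
  note L = pos_def_matrix_inv[OF \<Lambda>]
  have sym: "x \<bullet> (\<Lambda> *v y) = y \<bullet> (\<Lambda> *v x)" for x y
    using \<Lambda> by (metis dot_lmul_matrix inner_commute transpose_matrix_vector pos_def_matrix_def)
  have s0: "s i \<noteq> 0" for i using s[of i] by auto
  have det: "0 < det (diag_mat s)" by (simp add: det_diag_mat prod_pos s)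
  have ln_det: "ln (det (diag_mat s)) = (\<Sum>i\<in>UNIV. ln (s i))"
    unfolding det_diag_mat by (rule ln_prod) (simp_all add: s s0)
  \<comment> \<open>The log-ratio is expanded around \<open>\<mu>\<close>, the centre of
    \<open>q\<close>: \<open>B\<close> is its quadratic part and \<open>c\<close> collects what does
    not depend on \<open>\<theta>\<close>.\<close>
  define B where "B = (1 / 2) *\<^sub>R (\<Lambda> - diag_mat (\<lambda>i. 1 / s i))"
  define c where "c = ((\<mu> - \<nu>) \<bullet> (\<Lambda> *v (\<mu> - \<nu>)) + ln (det (matrix_inv \<Lambda>)) - ln (det (diag_mat s))) / 2"
  have "ln (gaussian_density \<mu> (diag_mat s) \<theta> / gaussian_density \<nu> (matrix_inv \<Lambda>) \<theta>) =
      (\<theta> - \<mu>) \<bullet> (B *v (\<theta> - \<mu>)) + (\<Lambda> *v (\<mu> - \<nu>)) \<bullet> (\<theta> - \<mu>) + c" for \<theta>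
  proof -
    have "(\<theta> - \<nu>) = (\<theta> - \<mu>) + (\<mu> - \<nu>)" by simp
    then have "(\<theta> - \<nu>) \<bullet> (\<Lambda> *v (\<theta> - \<nu>)) = (\<theta> - \<mu>) \<bullet> (\<Lambda> *v (\<theta> - \<mu>)) +
        2 * ((\<Lambda> *v (\<mu> - \<nu>)) \<bullet> (\<theta> - \<mu>)) + (\<mu> - \<nu>) \<bullet> (\<Lambda> *v (\<mu> - \<nu>))"
      using sym[of "\<mu> - \<nu>" "\<theta> - \<mu>"]
      by (simp only: matrix_vector_right_distrib inner_add_left inner_add_right inner_commute)
    moreover have "(\<theta> - \<mu>) \<bullet> (B *v (\<theta> - \<mu>)) = ((\<theta> - \<mu>) \<bullet> (\<Lambda> *v (\<theta> - \<mu>)) -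
        (\<theta> - \<mu>) \<bullet> (diag_mat (\<lambda>i. 1 / s i) *v (\<theta> - \<mu>))) / 2"
      by (simp only: B_def scaleR_matrix_vector_assoc[symmetric] matrix_vector_mult_diff_rdistrib
          inner_scaleR_right inner_diff_right)
    ultimately show ?thesis
      by (simp add: ln_gaussian_ratio[OF det L(1)] L(2) matrix_inv_diag_mat s0 c_def field_simps)
  qed
  then have "KL_div (gaussian_density \<mu> (diag_mat s)) (gaussian_density \<nu> (matrix_inv \<Lambda>)) =
      (\<Sum>i\<in>UNIV. B $ i $ i * s i) + c"
    using has_bochner_integral_integral_eq[OF gaussian_diag_quadratic[of s \<mu> B "\<Lambda> *v (\<mu> - \<nu>)" c, OF s]]
    by (subst KL_div_eq_integral)
      (auto simp: gaussian_density_pos det L(1) intro: less_imp_le)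
  also have "(\<Sum>i\<in>UNIV. B $ i $ i * s i) = (\<Sum>i\<in>UNIV. (\<Lambda> $ i $ i * s i - 1) / 2)"
    by (rule sum.cong) (auto simp: B_def s0 field_simps)
  finally show ?thesis
    by (simp add: c_def ln_det sum_subtractf sum_divide_distrib[symmetric] field_simps)
qed

text \<open>Each coordinate of the gradient is an affine function of
  \<open>\<theta> - \<mu>\<close>, given by a row of \<open>A\<close>, so the integral is a weighted
  sum of second moments. Weights and variances are independent parameters, so that the formula
  serves both a fixed \<open>M\<close> and the weight \<open>\<Sigma>\<close> itself.\<close>

lemma fisher_div_gaussian_diag:
  fixes \<mu> \<nu> :: "real ^ 'n"
  assumes \<Lambda>: "pos_def_matrix \<Lambda>" and s: "\<And>i. 0 < s i" and m: "\<And>i. 0 \<le> m i"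
  shows "fisher_div (diag_mat m) (gaussian_density \<mu> (diag_mat s)) (gaussian_density \<nu> (matrix_inv \<Lambda>)) =
    (\<Sum>k\<in>UNIV. m k * ((\<Sum>i\<in>UNIV. s i * (\<Lambda> $ k $ i - (if k = i then 1 / s i else 0))\<^sup>2) +
      ((\<Lambda> *v (\<mu> - \<nu>)) $ k)\<^sup>2))"
proof -
  note L = pos_def_matrix_inv[OF \<Lambda>]
  have s0: "s i \<noteq> 0" for i using s[of i] by auto
  have det: "0 < det (diag_mat s)" by (simp add: det_diag_mat prod_pos s)
  let ?g = "gaussian_density \<mu> (diag_mat s)"
  let ?c = "\<Lambda> *v (\<mu> - \<nu>)"
  define A where "A = \<Lambda> - diag_mat (\<lambda>i. 1 / s i)"
  have "gradient (\<lambda>t. ln (?g t / gaussian_density \<nu> (matrix_inv \<Lambda>) t)) \<theta> = A *v (\<theta> - \<mu>) + ?c" for \<theta>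
  proof -
    have "gradient (\<lambda>t. ln (?g t / gaussian_density \<nu> (matrix_inv \<Lambda>) t)) \<theta> =
        \<Lambda> *v (\<theta> - \<nu>) - diag_mat (\<lambda>i. 1 / s i) *v (\<theta> - \<mu>)"
      using \<Lambda> by (subst gradient_ln_gaussian_ratio)
        (simp_all add: det L matrix_inv_diag_mat s0 pos_def_matrix_def)
    also have "\<dots> = A *v (\<theta> - \<mu>) + ?c"
      by (simp add: A_def matrix_vector_mult_diff_rdistrib matrix_vector_mult_diff_distrib)
    finally show ?thesis .
  qed
  moreover have "(weighted_norm (diag_mat m) z)\<^sup>2 = (\<Sum>k\<in>UNIV. m k * (z $ k)\<^sup>2)" for z
    by (simp add: weighted_norm_def inner_diag_mat sum_nonneg m)
  moreover have "(A *v x + ?c) $ k = (A $ k) \<bullet> x + ?c $ k" for x k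
    by (simp add: matrix_vector_mul_component)
  ultimately have "fisher_div (diag_mat m) ?g (gaussian_density \<nu> (matrix_inv \<Lambda>)) =
      (\<integral>\<theta>. (\<Sum>k\<in>UNIV. m k * (?g \<theta> * (A $ k \<bullet> (\<theta> - \<mu>) + ?c $ k)\<^sup>2)) \<partial>lborel)"
    by (simp only: fisher_div_def sum_distrib_left mult_ac)
  also have "\<dots> = (\<Sum>k\<in>UNIV. m k * ((\<Sum>i\<in>UNIV. s i * (A $ k $ i)\<^sup>2) + (?c $ k)\<^sup>2))"
    by (intro has_bochner_integral_integral_eq has_bochner_integral_sum
        has_bochner_integral_mult_right gaussian_diag_affine_square s)
  moreover have "A $ k $ i = \<Lambda> $ k $ i - (if k = i then 1 / s i else 0)" for k i
    by (simp add: A_def)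
  ultimately show ?thesis by (simp only:)
qed

lemma fisher_div_gaussian_diag_expanded:
  fixes \<mu> \<nu> :: "real ^ 'n"
  assumes \<Lambda>: "pos_def_matrix \<Lambda>" and s: "\<And>i. 0 < s i" and m: "\<And>i. 0 \<le> m i"
  shows "fisher_div (diag_mat m) (gaussian_density \<mu> (diag_mat s)) (gaussian_density \<nu> (matrix_inv \<Lambda>)) =
    (\<Sum>k\<in>UNIV. m k * ((\<Sum>i\<in>UNIV. (\<Lambda> $ k $ i)\<^sup>2 * s i) - 2 * \<Lambda> $ k $ k + 1 / s k +
      ((\<Lambda> *v (\<mu> - \<nu>)) $ k)\<^sup>2))"
proof -
  have s0: "s i \<noteq> 0" for i using s[of i] by auto
  \<comment> \<open>Only the summand \<open>i = k\<close> meets \<open>1 / s k\<close>; its square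
    adds \<open>1 / s k - 2 * \<Lambda> $ k $ k\<close> to the generic term.\<close>
  have "(\<Sum>i\<in>UNIV. s i * (\<Lambda> $ k $ i - (if k = i then 1 / s i else 0))\<^sup>2) =
      (\<Sum>i\<in>UNIV. (\<Lambda> $ k $ i)\<^sup>2 * s i + (if k = i then 1 / s i - 2 * \<Lambda> $ k $ i else 0))" for k
    by (rule sum.cong) (auto simp: power2_eq_square s0 field_simps)
  then have "(\<Sum>i\<in>UNIV. s i * (\<Lambda> $ k $ i - (if k = i then 1 / s i else 0))\<^sup>2) =
      (\<Sum>i\<in>UNIV. (\<Lambda> $ k $ i)\<^sup>2 * s i) - 2 * \<Lambda> $ k $ k + 1 / s k" for k
    by (simp add: sum.distrib)
  then show ?thesis
    by (simp only: fisher_div_gaussian_diag[OF \<Lambda> s m])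
qed

text \<open>With the variances as weights, each \<open>1 / s k\<close> is multiplied by
  \<open>s k\<close> and becomes 1. The result is a polynomial, hence continuous up to the boundary
  of the positive orthant.\<close>

lemma fisher_div_gaussian_diag_score:
  fixes \<mu> \<nu> :: "real ^ 'n"
  assumes \<Lambda>: "pos_def_matrix \<Lambda>" and x: "\<And>i. 0 < x $ i"
  shows "fisher_div (diag_mat (($) x)) (gaussian_density \<mu> (diag_mat (($) x)))
      (gaussian_density \<nu> (matrix_inv \<Lambda>)) =
    x \<bullet> ((\<chi> i j. (\<Lambda> $ i $ j)\<^sup>2) *v x) +
      (\<chi> i. ((\<Lambda> *v (\<mu> - \<nu>)) $ i)\<^sup>2 - 2 * \<Lambda> $ i $ i) \<bullet> x + CARD('n)"
proof -
  have "x $ i \<noteq> 0" for i using x[of i] by auto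
  then have "x $ k * (a - 2 * \<Lambda> $ k $ k + 1 / x $ k + b) = x $ k * a + (b - 2 * \<Lambda> $ k $ k) * x $ k + 1"
    for k a b by (simp add: field_simps)
  then show ?thesis
    using x by (simp add: fisher_div_gaussian_diag_expanded[OF \<Lambda>] less_imp_le inner_vec_def
        matrix_vector_mult_def sum.distrib)
qed

text \<open>The limit in \<open>score_div\<close> is determined only along a nontrivial filter.
  Adding a small \<open>t > 0\<close> to every diagonal entry gives positive definite diagonal
  matrices that differ from the limit point and approach it.\<close>

lemma at_within_pos_def_diagonal_ne_bot:
  fixes x :: "real ^ 'n"
  assumes x: "\<And>i. 0 \<le> x $ i"
  shows "at (diag_mat (($) x)) within {T. diagonal_matrix T \<and> pos_def_matrix T} \<noteq> bot"
proof -
  let ?D = "{T :: real ^ 'n ^ 'n. diagonal_matrix T \<and> pos_def_matrix T}"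
  let ?T = "\<lambda>t. diag_mat (\<lambda>i. x $ i + t)"
  have "(?T \<longlongrightarrow> diag_mat (\<lambda>i. x $ i + 0)) (at_right 0)"
    unfolding diag_mat_def by (intro tendsto_intros vec_tendstoI) (auto intro!: tendsto_eq_intros)
  moreover have "\<forall>\<^sub>F t in at_right 0. ?T t \<in> closure (?D - {diag_mat (($) x)})"
    unfolding eventually_at_right_field
  proof (intro exI[of _ 1] conjI allI impI)
    fix t :: real assume t: "0 < t" "t < 1"
    then have "pos_def_matrix (?T t)" using x by (simp add: pos_def_diag_mat_iff add_nonneg_pos)
    moreover have "?T t \<noteq> diag_mat (($) x)" using t by (auto simp: vec_eq_iff)
    ultimately show "?T t \<in> closure (?D - {diag_mat (($) x)})"
      by (intro subsetD[OF closure_subset]) simp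
  qed simp
  ultimately have "diag_mat (\<lambda>i. x $ i + 0) \<in> closure (?D - {diag_mat (($) x)})"
    by (intro Lim_in_closed_set) auto
  then show ?thesis by (simp add: at_within_eq_bot_iff)
qed

lemma score_div_gaussian_diag:
  fixes \<mu> \<nu> :: "real ^ 'n"
  assumes \<Lambda>: "pos_def_matrix \<Lambda>" and x: "\<And>i. 0 \<le> x $ i"
  shows "score_div \<mu> (diag_mat (($) x)) (gaussian_density \<nu> (matrix_inv \<Lambda>)) =
    x \<bullet> ((\<chi> i j. (\<Lambda> $ i $ j)\<^sup>2) *v x) +
      (\<chi> i. ((\<Lambda> *v (\<mu> - \<nu>)) $ i)\<^sup>2 - 2 * \<Lambda> $ i $ i) \<bullet> x + CARD('n)"
    (is "_ = ?f x")
proof (cases "pos_def_matrix (diag_mat (($) x))")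
  case True
  then show ?thesis
    by (simp add: score_div_def fisher_div_gaussian_diag_score \<Lambda> pos_def_diag_mat_iff)
next
  case False
  let ?F = "at (diag_mat (($) x)) within {T. diagonal_matrix T \<and> pos_def_matrix T}"
  let ?p = "gaussian_density \<nu> (matrix_inv \<Lambda>)"
  have "((\<lambda>T :: real ^ 'n ^ 'n. \<chi> i. T $ i $ i) \<longlongrightarrow> (\<chi> i. diag_mat (($) x) $ i $ i)) ?F"
    by (intro tendsto_intros)
  then have lim: "((\<lambda>T :: real ^ 'n ^ 'n. \<chi> i. T $ i $ i) \<longlongrightarrow> x) ?F" by simp
  have "((\<lambda>T. ?f (\<chi> i. T $ i $ i)) \<longlongrightarrow> ?f x) ?F"
    by (intro tendsto_intros lim bounded_linear.tendsto[OF matrix_vector_mul_bounded_linear])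
  \<comment> \<open>Along the filter the divergence is the polynomial in the diagonal of
    \<open>T\<close>, so its limit is the value of the polynomial at \<open>x\<close>.\<close>
  moreover have "\<forall>\<^sub>F T in ?F. ?f (\<chi> i. T $ i $ i) = fisher_div T (gaussian_density \<mu> T) ?p"
    unfolding eventually_at_filter
  proof (intro always_eventually allI impI)
    fix T :: "real ^ 'n ^ 'n" assume "T \<in> {T. diagonal_matrix T \<and> pos_def_matrix T}"
    then have "T = diag_mat (($) (\<chi> i. T $ i $ i))" "0 < T $ i $ i" for i
      by (auto intro: diagonal_matrix_eqI simp: pos_def_matrix_diag)
    then show "?f (\<chi> i. T $ i $ i) = fisher_div T (gaussian_density \<mu> T) ?p"
      using fisher_div_gaussian_diag_score[OF \<Lambda>, of "\<chi> i. T $ i $ i" \<mu> \<nu>] by simp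
  qed
  ultimately have "((\<lambda>T. fisher_div T (gaussian_density \<mu> T) ?p) \<longlongrightarrow> ?f x) ?F"
    by (rule Lim_transform_eventually)
  then show ?thesis
    using False tendsto_Lim[OF at_within_pos_def_diagonal_ne_bot[OF x]] by (simp add: score_div_def)
qed

subsection \<open>Coordinatewise minimization\<close>

lemma separable_sum_coordinate_le:
  fixes h :: "'n :: finite \<Rightarrow> 'b \<Rightarrow> real"
  assumes "(\<Sum>j\<in>UNIV. h j (s j)) \<le> (\<Sum>j\<in>UNIV. h j ((s(i := t)) j))"
  shows "h i (s i) \<le> h i t"
proof -
  have "(\<Sum>j\<in>UNIV - {i}. h j ((s(i := t)) j)) = (\<Sum>j\<in>UNIV - {i}. h j (s j))"
    by (rule sum.cong) auto
  with assms show ?thesis by (simp add: sum.remove[of UNIV i])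
qed

section \<open>Minimizers of one-variable functions\<close>

lemma linear_minus_ln_minimizer:
  fixes a s :: real
  assumes "0 < a" "0 < s" and min: "\<And>t. 0 < t \<Longrightarrow> a * s - ln s \<le> a * t - ln t"
  shows "a * s = 1"
proof (rule ln_eq_minus_one)
  show "0 < a * s" using assms by simp
  \<comment> \<open>Comparison with the minimizer \<open>1 / a\<close> forces equality in
    \<open>ln y \<le> y - 1\<close> at \<open>y = a * s\<close>, which happens only at 1.\<close>
  have "a * s - 1 \<le> ln (a * s)" using min[of "1 / a"] assms by (simp add: ln_div ln_mult)
  with ln_le_minus_one[of "a * s"] show "ln (a * s) = a * s - 1" using assms by simp
qed

lemma linear_plus_inverse_minimizer:
  fixes a m s :: real
  assumes "0 < a" "0 < m" "0 < s" and min: "\<And>t. 0 < t \<Longrightarrow> a * s + m / s \<le> a * t + m / t"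
  shows "a * s\<^sup>2 = m"
proof -
  \<comment> \<open>The point where the two summands balance; comparing with it turns minimality
    into \<open>(s - t)\<^sup>2 \<le> 0\<close>.\<close>
  define t where "t = sqrt (m / a)"
  have t: "0 < t" "a * t\<^sup>2 = m" using assms by (auto simp: t_def)
  have "a * s + a * t\<^sup>2 / s \<le> a * t + a * t\<^sup>2 / t" using min[OF t(1)] t(2) by simp
  then have "a * (s + t\<^sup>2 / s) \<le> a * (2 * t)"
    using t(1) by (simp add: power2_eq_square distrib_left)
  then have "s + t\<^sup>2 / s \<le> 2 * t" using assms(1) by simp
  then have "(s - t)\<^sup>2 \<le> 0" using assms by (simp add: power2_eq_square field_simps)
  then show ?thesis using t(2) by simp
qed

lemma quadratic_boundary_slope_nonpos:
  fixes s \<beta> \<gamma> :: real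
  assumes "0 < s" "0 < \<gamma>" and nonneg: "\<And>d. - s \<le> d \<Longrightarrow> 0 \<le> d * \<beta> + d\<^sup>2 * \<gamma>"
  shows "\<beta> \<le> 0"
proof (rule ccontr)
  assume "\<not> \<beta> \<le> 0"
  then have \<beta>: "0 < \<beta>" by simp
  \<comment> \<open>A downward move: the bound \<open>s\<close> keeps it feasible, the other bound
    makes the linear gain exceed the quadratic loss.\<close>
  define d where "d = min s (\<beta> / (2 * \<gamma>))"
  have d: "0 < d" "d \<le> s" "d * \<gamma> < \<beta>"
    using assms \<beta> by (auto simp: d_def min_def field_simps)
  have "0 \<le> d * (d * \<gamma> - \<beta>)" using nonneg[of "- d"] d by (simp add: power2_eq_square algebra_simps)
  with d show False by (simp add: zero_le_mult_iff)
qed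

section \<open>Optimality conditions for the three divergences\<close>

lemma KL_minimizer_diagonal:
  fixes \<mu> \<nu> :: "real ^ 'n"
  assumes \<Lambda>: "pos_def_matrix \<Lambda>"
    and min: "is_arg_min (\<lambda>(\<mu>, \<Sigma>). KL_div (gaussian_density \<mu> \<Sigma>) (gaussian_density \<nu> (matrix_inv \<Lambda>)))
           (\<lambda>(\<mu>, \<Sigma>). diagonal_matrix \<Sigma> \<and> pos_def_matrix \<Sigma>) (\<mu>, \<Sigma>)"
  shows "\<Lambda> $ i $ i * \<Sigma> $ i $ i = 1"
proof -
  define s where "s j = \<Sigma> $ j $ j" for j
  have \<Sigma>: "\<Sigma> = diag_mat s" and s: "0 < s j" for j
    using min by (auto intro: diagonal_matrix_eqI simp: is_arg_min_def s_def pos_def_matrix_diag)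
  have "\<Lambda> $ i $ i * s i = 1"
  proof (rule linear_minus_ln_minimizer)
    \<comment> \<open>The competitor keeps the mean and changes one variance, so the term in
      \<open>\<mu> - \<nu>\<close> cancels.\<close>
    fix t :: real assume t: "0 < t"
    then have s': "0 < (s(i := t)) j" for j using s by simp
    then have "KL_div (gaussian_density \<mu> (diag_mat s)) (gaussian_density \<nu> (matrix_inv \<Lambda>))
        \<le> KL_div (gaussian_density \<mu> (diag_mat (s(i := t)))) (gaussian_density \<nu> (matrix_inv \<Lambda>))"
      using min by (force simp: is_arg_min_def \<Sigma> pos_def_diag_mat_iff not_less)
    then have "(\<Sum>j\<in>UNIV. \<Lambda> $ j $ j * s j - ln (s j)) \<le>
        (\<Sum>j\<in>UNIV. \<Lambda> $ j $ j * (s(i := t)) j - ln ((s(i := t)) j))"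
      unfolding KL_div_gaussian_diag[OF \<Lambda> s] KL_div_gaussian_diag[OF \<Lambda> s'] by simp
    then show "\<Lambda> $ i $ i * s i - ln (s i) \<le> \<Lambda> $ i $ i * t - ln t"
      by (rule separable_sum_coordinate_le)
  qed (use \<Lambda> s in \<open>simp_all add: pos_def_matrix_diag\<close>)
  then show ?thesis by (simp add: s_def)
qed

lemma fisher_minimizer_diagonal:
  fixes \<mu> \<nu> :: "real ^ 'n"
  assumes \<Lambda>: "pos_def_matrix \<Lambda>" and M: "diagonal_matrix M" "pos_def_matrix M"
    and min: "is_arg_min (\<lambda>(\<mu>, \<Sigma>). fisher_div M (gaussian_density \<mu> \<Sigma>) (gaussian_density \<nu> (matrix_inv \<Lambda>)))
           (\<lambda>(\<mu>, \<Sigma>). diagonal_matrix \<Sigma> \<and> pos_def_matrix \<Sigma>) (\<mu>, \<Sigma>)"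
  shows "(\<Sum>k\<in>UNIV. M $ k $ k * (\<Lambda> $ k $ i)\<^sup>2) * (\<Sigma> $ i $ i)\<^sup>2 = M $ i $ i"
proof -
  define s where "s j = \<Sigma> $ j $ j" for j
  define m where "m j = M $ j $ j" for j
  define a where "a j = (\<Sum>k\<in>UNIV. m k * (\<Lambda> $ k $ j)\<^sup>2)" for j
  have \<Sigma>: "\<Sigma> = diag_mat s" and s: "0 < s j" for j
    using min by (auto intro: diagonal_matrix_eqI simp: is_arg_min_def s_def pos_def_matrix_diag)
  have m: "0 < m j" and M_eq: "M = diag_mat m" for j
    using M by (auto intro: diagonal_matrix_eqI simp: m_def pos_def_matrix_diag)
  have eq: "fisher_div M (gaussian_density \<mu> (diag_mat r)) (gaussian_density \<nu> (matrix_inv \<Lambda>)) =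
      (\<Sum>j\<in>UNIV. a j * r j + m j / r j) +
      (\<Sum>j\<in>UNIV. m j * (((\<Lambda> *v (\<mu> - \<nu>)) $ j)\<^sup>2 - 2 * \<Lambda> $ j $ j))" if r: "\<And>j. 0 < r j" for r
  proof -
    \<comment> \<open>Exchanging the sums collects the coefficient of each variance and makes the
      objective separable.\<close>
    have "(\<Sum>j\<in>UNIV. a j * r j) = (\<Sum>k\<in>UNIV. m k * (\<Sum>j\<in>UNIV. (\<Lambda> $ k $ j)\<^sup>2 * r j))"
      unfolding a_def sum_distrib_left sum_distrib_right mult.assoc by (rule sum.swap)
    then show ?thesis
      using m by (simp add: M_eq fisher_div_gaussian_diag_expanded[OF \<Lambda> r] less_imp_le
          algebra_simps sum.distrib sum_subtractf)
  qed
  have "a i * (s i)\<^sup>2 = m i"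
  proof (rule linear_plus_inverse_minimizer)
    show "0 < a i"
      unfolding a_def using m pos_def_matrix_diag[OF \<Lambda>, of i]
      by (intro sum_pos2[of _ i]) (auto simp: less_imp_le)
    fix t :: real assume t: "0 < t"
    then have s': "0 < (s(i := t)) j" for j using s by simp
    then have "fisher_div M (gaussian_density \<mu> (diag_mat s)) (gaussian_density \<nu> (matrix_inv \<Lambda>))
        \<le> fisher_div M (gaussian_density \<mu> (diag_mat (s(i := t)))) (gaussian_density \<nu> (matrix_inv \<Lambda>))"
      using min by (force simp: is_arg_min_def \<Sigma> pos_def_diag_mat_iff not_less)
    then have "(\<Sum>j\<in>UNIV. a j * s j + m j / s j) \<le>
        (\<Sum>j\<in>UNIV. a j * (s(i := t)) j + m j / (s(i := t)) j)"
      unfolding eq[OF s] eq[OF s'] by simp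
    then show "a i * s i + m i / s i \<le> a i * t + m i / t"
      by (rule separable_sum_coordinate_le)
  qed (use m s in auto)
  then show ?thesis by (simp add: s_def m_def a_def)
qed

text \<open>First-order condition in coordinate \<open>i\<close> at fixed mean. The objective is not
  separable, and a positive entry is required so that it can be decreased.\<close>

lemma score_minimizer_diagonal:
  fixes \<mu> \<nu> :: "real ^ 'n"
  assumes \<Lambda>: "pos_def_matrix \<Lambda>"
    and min: "is_arg_min (\<lambda>(\<mu>, \<Sigma>). score_div \<mu> \<Sigma> (gaussian_density \<nu> (matrix_inv \<Lambda>)))
           (\<lambda>(\<mu>, \<Sigma>). diagonal_matrix \<Sigma> \<and> pos_semidef_matrix \<Sigma>) (\<mu>, \<Sigma>)"
    and pos: "0 < \<Sigma> $ i $ i"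
  shows "(\<Sum>j\<in>UNIV. (\<Lambda> $ i $ j)\<^sup>2 * \<Sigma> $ j $ j) \<le> \<Lambda> $ i $ i"
proof -
  define x where "x = (\<chi> j. \<Sigma> $ j $ j)"
  define G where "G = (\<chi> i j. (\<Lambda> $ i $ j)\<^sup>2)"
  define h where "h = (\<chi> i. ((\<Lambda> *v (\<mu> - \<nu>)) $ i)\<^sup>2 - 2 * \<Lambda> $ i $ i)"
  have \<Sigma>: "\<Sigma> = diag_mat (($) x)" and x: "0 \<le> x $ j" for j
    using min by (auto intro: diagonal_matrix_eqI simp: is_arg_min_def x_def pos_semidef_matrix_diag)
  have sym: "transpose G = G"
    using \<Lambda> by (simp add: pos_def_matrix_def transpose_def G_def vec_eq_iff)
  have "2 * (G *v x) $ i + h $ i \<le> 0"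
  proof (rule quadratic_boundary_slope_nonpos)
    show "0 < x $ i" using pos by (simp add: x_def)
    show "0 < G $ i $ i" using pos_def_matrix_diag[OF \<Lambda>, of i] by (simp add: G_def)
    fix d assume d: "- x $ i \<le> d"
    let ?e = "axis i 1 :: real ^ 'n"
    let ?y = "x + d *\<^sub>R ?e"
    have y: "0 \<le> ?y $ j" for j using d x by (simp add: axis_def)
    then have "score_div \<mu> (diag_mat (($) x)) (gaussian_density \<nu> (matrix_inv \<Lambda>)) \<le>
        score_div \<mu> (diag_mat (($) ?y)) (gaussian_density \<nu> (matrix_inv \<Lambda>))"
      using min by (force simp: is_arg_min_def \<Sigma> pos_semidef_diag_mat_iff not_less)
    then have "x \<bullet> (G *v x) + h \<bullet> x \<le> ?y \<bullet> (G *v ?y) + h \<bullet> ?y"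
      by (simp only: score_div_gaussian_diag[OF \<Lambda> x] score_div_gaussian_diag[OF \<Lambda> y] G_def h_def add_le_cancel_right)
    \<comment> \<open>Symmetry of \<open>G\<close> makes the two cross terms equal, so the slope
      along \<open>?e\<close> is \<open>2 * (G *v x) $ i + h $ i\<close>.\<close>
    moreover have "x \<bullet> (G *v ?e) = (G *v x) $ i"
      using sym by (metis cart_eq_inner_axis dot_lmul_matrix transpose_matrix_vector)
    moreover have "?e \<bullet> (G *v x) = (G *v x) $ i" "h \<bullet> ?e = h $ i"
      by (simp_all add: inner_axis inner_axis')
    moreover have "?e \<bullet> (G *v ?e) = G $ i $ i" by (rule axis_inner_matrix_mult_axis)
    ultimately show "0 \<le> d * (2 * (G *v x) $ i + h $ i) + d\<^sup>2 * G $ i $ i"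
      by (simp add: matrix_vector_right_distrib matrix_vector_mult_scaleR inner_add_left
          inner_add_right power2_eq_square algebra_simps)
  qed
  \<comment> \<open>The mean enters \<open>h $ i\<close> as a nonnegative square; dropping it gives
    a bound valid for whatever mean is optimal.\<close>
  then have "2 * (G *v x) $ i \<le> 2 * \<Lambda> $ i $ i"
    using zero_le_power2[of "(\<Lambda> *v (\<mu> - \<nu>)) $ i"] unfolding h_def vec_lambda_beta by linarith
  then show ?thesis by (simp add: G_def x_def matrix_vector_mult_def)
qed

section \<open>Comparison of the optimal variances\<close>

lemma two_terms_le_sum:
  fixes f :: "'a :: finite \<Rightarrow> real"
  assumes "\<And>k. 0 \<le> f k" "i \<noteq> j"
  shows "f i + f j \<le> sum f UNIV"
proof -
  have "sum f {i, j} \<le> sum f UNIV" by (rule sum_mono2) (use assms in auto)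
  with assms(2) show ?thesis by simp
qed

theorem theorem1:
  fixes \<nu> \<mu>KL \<mu>M \<mu>S :: "real ^ 'n"
    and \<Lambda> M \<Sigma>KL \<Sigma>M \<Sigma>S :: "real ^ 'n ^ 'n"
    and p :: "real ^ 'n \<Rightarrow> real"
  assumes "pos_def_matrix \<Lambda>"
    and "p = gaussian_density \<nu> (matrix_inv \<Lambda>)"
    and "diagonal_matrix M" and "pos_def_matrix M"
    and "is_arg_min (\<lambda>(\<mu>, \<Sigma>). KL_div (gaussian_density \<mu> \<Sigma>) p)
           (\<lambda>(\<mu>, \<Sigma>). diagonal_matrix \<Sigma> \<and> pos_def_matrix \<Sigma>) (\<mu>KL, \<Sigma>KL)"
    and "is_arg_min (\<lambda>(\<mu>, \<Sigma>). fisher_div M (gaussian_density \<mu> \<Sigma>) p)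
           (\<lambda>(\<mu>, \<Sigma>). diagonal_matrix \<Sigma> \<and> pos_def_matrix \<Sigma>) (\<mu>M, \<Sigma>M)"
    and "is_arg_min (\<lambda>(\<mu>, \<Sigma>). score_div \<mu> \<Sigma> p)
           (\<lambda>(\<mu>, \<Sigma>). diagonal_matrix \<Sigma> \<and> pos_semidef_matrix \<Sigma>) (\<mu>S, \<Sigma>S)"
  shows "(\<forall>i. \<Sigma>M $ i $ i \<le> \<Sigma>KL $ i $ i \<and> \<Sigma>S $ i $ i \<le> \<Sigma>KL $ i $ i) \<and>
    (\<not> diagonal_matrix \<Lambda> \<longrightarrow>
      (\<exists>i. \<Sigma>M $ i $ i < \<Sigma>KL $ i $ i \<and> \<Sigma>S $ i $ i < \<Sigma>KL $ i $ i))"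
proof -
  note \<Lambda> = assms(1) and min = assms(5-7)[unfolded assms(2)]
  define l where "l i = \<Lambda> $ i $ i" for i
  define s where "s i = \<Sigma>S $ i $ i" for i
  define v where "v i = \<Sigma>M $ i $ i" for i
  define m where "m i = M $ i $ i" for i
  have l: "0 < l i" and m: "0 < m i" for i
    using \<Lambda> assms(4) by (auto simp: l_def m_def pos_def_matrix_diag)
  have v: "0 < v i" for i
    using min(2) by (auto simp: v_def is_arg_min_def pos_def_matrix_diag)
  have s: "0 \<le> s i" for i
    using min(3) by (auto simp: s_def is_arg_min_def pos_semidef_matrix_diag)
  have sym: "\<Lambda> $ i $ j = \<Lambda> $ j $ i" for i j
    using \<Lambda> by (simp add: pos_def_matrix_def transpose_def vec_eq_iff)
  have KL: "\<Sigma>KL $ i $ i = 1 / l i" for i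
    using KL_minimizer_diagonal[OF \<Lambda> min(1), of i] l[of i] by (simp add: l_def field_simps)
  have vM: "(\<Sum>k\<in>UNIV. m k * (\<Lambda> $ k $ i)\<^sup>2) * (v i)\<^sup>2 = m i" for i
    using fisher_minimizer_diagonal[OF \<Lambda> assms(3,4) min(2)] by (simp add: m_def v_def)
  have sS: "(\<Sum>j\<in>UNIV. (\<Lambda> $ i $ j)\<^sup>2 * s j) \<le> l i" if "0 < s i" for i
    using score_minimizer_diagonal[OF \<Lambda> min(3), of i] that by (simp add: s_def l_def)
  have M_le: "v i \<le> 1 / l i" for i
  proof -
    \<comment> \<open>Keeping only the summand \<open>k = i\<close> turns the optimality equation
      into \<open>(l i * v i)\<^sup>2 \<le> 1\<close>.\<close>
    have "m i * (l i)\<^sup>2 \<le> (\<Sum>k\<in>UNIV. m k * (\<Lambda> $ k $ i)\<^sup>2)"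
      using m by (subst l_def, intro member_le_sum) (auto simp: less_imp_le)
    then have "m i * (l i)\<^sup>2 * (v i)\<^sup>2 \<le> m i"
      unfolding vM[of i, symmetric] by (rule mult_right_mono) simp
    then have "(l i * v i)\<^sup>2 \<le> 1\<^sup>2" using m[of i] by (simp add: power_mult_distrib)
    then have "l i * v i \<le> 1" by (rule power2_le_imp_le) simp
    then show ?thesis using l[of i] by (simp add: field_simps)
  qed
  have M_less: "v i < 1 / l i" if "j \<noteq> i" "\<Lambda> $ j $ i \<noteq> 0" for i j
  proof -
    \<comment> \<open>A nonzero entry in column \<open>i\<close> off the diagonal adds a second,
      strictly positive summand.\<close>
    have "m i * (l i)\<^sup>2 < m i * (\<Lambda> $ i $ i)\<^sup>2 + m j * (\<Lambda> $ j $ i)\<^sup>2"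
      using m that by (simp add: l_def)
    also have "\<dots> \<le> (\<Sum>k\<in>UNIV. m k * (\<Lambda> $ k $ i)\<^sup>2)"
      using m that by (intro two_terms_le_sum) (auto simp: less_imp_le)
    finally have "m i * (l i)\<^sup>2 * (v i)\<^sup>2 < m i"
      using v[of i] by (subst (2) vM[of i, symmetric]) (simp add: mult_strict_right_mono)
    then have "(l i * v i)\<^sup>2 < 1\<^sup>2" using m[of i] by (simp add: power_mult_distrib)
    then have "l i * v i < 1" by (rule power2_less_imp_less) simp
    then show ?thesis using l[of i] by (simp add: field_simps)
  qed
  have S_le: "s i \<le> 1 / l i" for i
  proof (cases "0 < s i")
    case True
    have "(l i)\<^sup>2 * s i \<le> (\<Sum>j\<in>UNIV. (\<Lambda> $ i $ j)\<^sup>2 * s j)"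
      using s by (subst l_def, intro member_le_sum) auto
    with sS[OF True] have "l i * (l i * s i) \<le> l i * 1" by (simp add: power2_eq_square mult.assoc)
    then show ?thesis using l[of i] by (simp add: field_simps)
  next
    case False
    then have "s i \<le> 0" by simp
    also have "0 \<le> 1 / l i" using l[of i] by simp
    finally show ?thesis .
  qed
  \<comment> \<open>Here the extra summand carries the factor \<open>s j\<close>, so strictness at
    \<open>i\<close> needs the coupled variance \<open>s j\<close> to be positive.\<close>
  have S_less: "s i < 1 / l i" if "j \<noteq> i" "\<Lambda> $ i $ j \<noteq> 0" "0 < s j" for i j
  proof (cases "0 < s i")
    case True
    have "(l i)\<^sup>2 * s i < (\<Lambda> $ i $ i)\<^sup>2 * s i + (\<Lambda> $ i $ j)\<^sup>2 * s j"
      using that by (simp add: l_def)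
    also have "\<dots> \<le> (\<Sum>j\<in>UNIV. (\<Lambda> $ i $ j)\<^sup>2 * s j)"
      using s that by (intro two_terms_le_sum) auto
    finally have "l i * (l i * s i) < l i * 1"
      using sS[OF True] by (simp add: power2_eq_square mult.assoc)
    then show ?thesis using l[of i] by (simp add: field_simps)
  next
    case False
    then have "s i \<le> 0" by simp
    also have "0 < 1 / l i" using l[of i] by simp
    finally show ?thesis .
  qed
  \<comment> \<open>For diagonal \<open>\<Lambda>\<close> all three optima equal
    \<open>1 / l i\<close>, so strictness has to come from an off-diagonal entry. By symmetry that
    entry makes the bound on \<open>v\<close> strict at both of its indices, which leaves the choice
    to \<open>s\<close>.\<close>
  have "\<exists>i. v i < 1 / l i \<and> s i < 1 / l i" if nd: "\<not> diagonal_matrix \<Lambda>"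
  proof -
    from nd obtain i j where ij: "i \<noteq> j" "\<Lambda> $ i $ j \<noteq> 0" by (auto simp: diagonal_matrix_def)
    show ?thesis
    proof (cases "0 < s j")
      case True
      then show ?thesis using M_less[of j i] S_less[of j i] ij sym by metis
    next
      case False
      then have "s j < 1 / l j" using l[of j] by (smt (verit) divide_pos_pos)
      then show ?thesis using M_less[of i j] ij by blast
    qed
  qed
  with M_le S_le show ?thesis unfolding KL by (simp add: v_def s_def)
qed

end
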